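(* Let $G$ be a $2K_2$-free graph with $D(G)=5$. Then there exists a $D$-partition of $G$ that contains a sink set.
   Context: All graphs are finite and simple. $G$ is $2K_2$-free if it has no induced subgraph consisting of two independent edges. For disjoint vertex sets $A,B$, $A$ dominates $B$ if every vertex of $B$ is adjacent to at least one vertex of $A$. An upper domatic partition of size $k$ is a partition of $V(G)$ into $k$ nonempty parts such that for any two parts $V_i,V_j$, $V_i$ dominates $V_j$ or $V_j$ dominates $V_i$ (or both); $D(G)$ is the maximum such $k$, and a $D$-partition is an upper domatic partition of size $D(G)$. A part of a partition with $k$ parts is a sink set if it is dominated by all the other $k-1$ parts. *)

theory Defs
  imports Graph_Theory.Pair_Digraph Graph_Theory.Digraph_Component "HOL-Library.Disjoint_Sets"
begin

text \<open>
  A finite simple graph is a \<^term>\<open>pair_graph\<close>: a finite vertex set \<^term>\<open>pverts G\<close> together with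
  an irreflexive symmetric set \<^term>\<open>parcs G\<close> of ordered pairs, so that each undirected edge
  occurs in both orientations.
\<close>

definition two_K2_free :: "'a pair_pre_digraph \<Rightarrow> bool" where
  "two_K2_free G \<longleftrightarrow>
    \<not> (\<exists>a b c d. distinct [a, b, c, d] \<and> {a, b, c, d} \<subseteq> pverts G \<and>
        arcs (with_proj G \<restriction> {a, b, c, d}) = {(a, b), (b, a), (c, d), (d, c)})"

definition set_dominates :: "'a pair_pre_digraph \<Rightarrow> 'a set \<Rightarrow> 'a set \<Rightarrow> bool" where
  "set_dominates G A B \<longleftrightarrow> (\<forall>v\<in>B. \<exists>u\<in>A. (u, v) \<in> parcs G)"

text \<open>Nonemptiness of the parts is included in \<^const>\<open>partition_on\<close>.\<close>

definition upper_domatic_partition :: "'a pair_pre_digraph \<Rightarrow> 'a set set \<Rightarrow> bool" where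
  "upper_domatic_partition G P \<longleftrightarrow>
    partition_on (pverts G) P \<and>
    (\<forall>A\<in>P. \<forall>B\<in>P. A \<noteq> B \<longrightarrow> set_dominates G A B \<or> set_dominates G B A)"

text \<open>
  For a finite graph the maximum is over a finite nonempty set; see
  \<open>upper_domatic_sizes_finite\<close> and \<open>upper_domatic_sizes_nonempty\<close> below.
\<close>

definition upper_domatic_number :: "'a pair_pre_digraph \<Rightarrow> nat" where
  "upper_domatic_number G = Max (card ` {P. upper_domatic_partition G P})"

definition D_partition :: "'a pair_pre_digraph \<Rightarrow> 'a set set \<Rightarrow> bool" where
  "D_partition G P \<longleftrightarrow> upper_domatic_partition G P \<and> card P = upper_domatic_number G"

definition sink_set :: "'a pair_pre_digraph \<Rightarrow> 'a set set \<Rightarrow> 'a set \<Rightarrow> bool" where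
  "sink_set G P S \<longleftrightarrow> S \<in> P \<and> (\<forall>A\<in>P - {S}. set_dominates G A S)"

lemma upper_domatic_sizes_finite:
  assumes "pair_graph G"
  shows "finite (card ` {P. upper_domatic_partition G P})"
proof -
  interpret pair_graph G by fact
  have "{P. upper_domatic_partition G P} \<subseteq> Pow (Pow (pverts G))"
    by (auto simp: upper_domatic_partition_def partition_on_def)
  then show ?thesis
    using pair_finite_verts by (meson finite_Pow_iff finite_imageI finite_subset)
qed

lemma upper_domatic_sizes_nonempty: "card ` {P. upper_domatic_partition G P} \<noteq> {}"
proof -
  have "upper_domatic_partition G ({pverts G} - {{}})"
    by (auto simp: upper_domatic_partition_def partition_on_def disjoint_def)
  then show ?thesis by blast
qed

lemma two_K2_free_iff:
  assumes "pair_graph G"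
  shows "two_K2_free G \<longleftrightarrow>
    \<not> (\<exists>a b c d. distinct [a, b, c, d] \<and> (a, b) \<in> parcs G \<and> (c, d) \<in> parcs G \<and>
        (a, c) \<notin> parcs G \<and> (a, d) \<notin> parcs G \<and> (b, c) \<notin> parcs G \<and> (b, d) \<notin> parcs G)"
proof -
  interpret pair_graph G by fact
  have sym: "(v, u) \<in> parcs G" if "(u, v) \<in> parcs G" for u v
    using that pair_sym_arcs by (auto simp: symmetric_def dest: symD)
  have irr: "(u, u) \<notin> parcs G" for u
    using pair_no_loops by force
  have "({a, b, c, d} \<subseteq> pverts G \<and>
      arcs (with_proj G \<restriction> {a, b, c, d}) = {(a, b), (b, a), (c, d), (d, c)}) \<longleftrightarrow>
      (a, b) \<in> parcs G \<and> (c, d) \<in> parcs G \<and>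
      (a, c) \<notin> parcs G \<and> (a, d) \<notin> parcs G \<and> (b, c) \<notin> parcs G \<and> (b, d) \<notin> parcs G"
    (is "?L \<longleftrightarrow> ?R") if d: "distinct [a, b, c, d]" for a b c d
  proof
    assume L: ?L
    have "(u, v) \<in> parcs G \<longleftrightarrow> (u, v) \<in> {(a, b), (b, a), (c, d), (d, c)}"
      if "u \<in> {a, b, c, d}" "v \<in> {a, b, c, d}" for u v
    proof -
      have "(u, v) \<in> parcs G \<longleftrightarrow> (u, v) \<in> arcs (with_proj G \<restriction> {a, b, c, d})"
        using that by (simp del: insert_iff)
      then show ?thesis using L by metis
    qed
    from this[of a b] this[of c d] this[of a c] this[of a d] this[of b c] this[of b d]
    show ?R using d by auto
  next
    assume R: ?R
    then have "{a, b, c, d} \<subseteq> pverts G"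
      by (auto dest: in_arcsD1 in_arcsD2)
    moreover have "arcs (with_proj G \<restriction> {a, b, c, d}) = {(a, b), (b, a), (c, d), (d, c)}"
    proof -
      have "(b, a) \<in> parcs G" "(d, c) \<in> parcs G"
        "(c, a) \<notin> parcs G" "(d, a) \<notin> parcs G" "(c, b) \<notin> parcs G" "(d, b) \<notin> parcs G"
        using R sym by blast+
      with R irr have "(u, v) \<in> parcs G \<and> u \<in> {a, b, c, d} \<and> v \<in> {a, b, c, d} \<longleftrightarrow>
          (u, v) \<in> {(a, b), (b, a), (c, d), (d, c)}" for u v
        by (elim conjE) (safe, simp_all)
      then show ?thesis by (simp add: set_eq_iff)
    qed
    ultimately show ?L by blast
  qed
  then show ?thesis unfolding two_K2_free_def by blast
qed

end

theory Submission
  imports Defs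
begin

text \<open>
  If a vertex \<open>v\<close> of a part \<open>S\<close> has neighbours in all other parts, \<open>{v}\<close> becomes a sink set as soon
  as the rest of \<open>S\<close> can be distributed over the other parts; a vertex \<open>x\<close> may be moved to \<open>A\<close> if it
  has a neighbour in every part that dominates \<open>A\<close>. Such \<open>v\<close> exists, and all moves are possible,
  whenever at most one part fails to dominate \<open>S\<close>. Otherwise every part fails to be dominated by two
  others, so domination among the five parts is the regular tournament \<open>i \<rightarrow> i + 1, i + 2\<close> modulo \<open>5\<close>.
  There all moves are possible again, and if no part contains a suitable \<open>v\<close>, then an edge between
  parts \<open>1\<close> and \<open>3\<close> and one between parts \<open>0\<close> and \<open>2\<close> form an induced \<open>2K\<^sub>2\<close>.
\<close>

definition has_nbr_in :: "'a pair_pre_digraph \<Rightarrow> 'a \<Rightarrow> 'a set \<Rightarrow> bool" where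
  "has_nbr_in G x A \<longleftrightarrow> (\<exists>u\<in>A. (u, x) \<in> parcs G)"

lemma set_dominates_iff: "set_dominates G A B \<longleftrightarrow> (\<forall>x\<in>B. has_nbr_in G x A)"
  by (simp add: set_dominates_def has_nbr_in_def)

lemma has_nbr_in_mono: "has_nbr_in G x A \<Longrightarrow> A \<subseteq> B \<Longrightarrow> has_nbr_in G x B"
  by (auto simp: has_nbr_in_def)

lemma has_nbr_in_arc:
  assumes "pair_graph G" "(u, v) \<in> parcs G"
  shows "v \<in> A \<Longrightarrow> has_nbr_in G u A" "u \<in> A \<Longrightarrow> has_nbr_in G v A"
proof -
  interpret pair_graph G by fact
  have "(v, u) \<in> parcs G" using assms(2) pair_sym_arcs by (auto simp: symmetric_def dest: symD)
  then show "v \<in> A \<Longrightarrow> has_nbr_in G u A" "u \<in> A \<Longrightarrow> has_nbr_in G v A"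
    using assms(2) by (auto simp: has_nbr_in_def)
qed

lemma set_dominates_obtain:
  assumes "pair_graph G" "set_dominates G A B" "B \<noteq> {}"
  obtains x where "x \<in> A" "has_nbr_in G x B"
proof -
  obtain x y where "x \<in> A" "y \<in> B" "(x, y) \<in> parcs G"
    using assms(2,3) unfolding set_dominates_def by (metis ex_in_conv)
  then show ?thesis using that has_nbr_in_arc(1)[OF assms(1)] by blast
qed

text \<open>Every vertex of \<open>S\<close> except \<open>v\<close> joins another part, and
  \<open>{v}\<close> takes the place of \<open>S\<close>, so the number of parts is kept. Since the
  other parts only grow, they still dominate \<open>{v}\<close>, and domination among them can only
  fail at newly arrived vertices, which \<open>move\<close> prevents.\<close>

lemma sink_partition_by_moving:
  assumes P: "upper_domatic_partition G P" and finP: "finite P" and S: "S \<in> P" and v: "v \<in> S"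
    and v_nbr: "\<And>A. A \<in> P - {S} \<Longrightarrow> has_nbr_in G v A"
    and move: "\<And>x. x \<in> S \<Longrightarrow> \<exists>A\<in>P - {S}. \<forall>B\<in>P - {S, A}. has_nbr_in G x B \<or> \<not> set_dominates G B A"
  shows "\<exists>Q. upper_domatic_partition G Q \<and> card Q = card P \<and> sink_set G Q {v}"
proof -
  have part: "partition_on (pverts G) P"
    and semi: "\<And>A B. A \<in> P \<Longrightarrow> B \<in> P \<Longrightarrow> A \<noteq> B \<Longrightarrow> set_dominates G A B \<or> set_dominates G B A"
    using P by (auto simp: upper_domatic_partition_def)
  have un: "\<Union>P = pverts G" and ne: "\<And>A. A \<in> P \<Longrightarrow> A \<noteq> {}"
    and dj: "\<And>A B x. A \<in> P \<Longrightarrow> B \<in> P \<Longrightarrow> x \<in> A \<Longrightarrow> x \<in> B \<Longrightarrow> A = B"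
    using part by (auto simp: partition_on_def disjoint_def)
  obtain f where f: "\<And>x. x \<in> S \<Longrightarrow> f x \<in> P - {S}"
    and f_dom: "\<And>x B. x \<in> S \<Longrightarrow> B \<in> P - {S, f x} \<Longrightarrow> has_nbr_in G x B \<or> \<not> set_dominates G B (f x)"
    using move by metis
  define h where "h A = A \<union> {x \<in> S - {v}. f x = A}" for A
  define Q where "Q = insert {v} (h ` (P - {S}))"
  have sub: "A \<subseteq> h A" for A by (auto simp: h_def)
  \<comment> \<open>A moved vertex lies in \<open>S\<close>, hence in no other old part, and
    \<open>f\<close> sends it to a single part.\<close>
  have h_disj: "A = B" if "A \<in> P - {S}" "B \<in> P - {S}" "x \<in> h A" "x \<in> h B" for A B x
    using that dj S unfolding h_def by blast
  have v_notin: "v \<notin> h A" if "A \<in> P - {S}" for A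
    using that dj S v unfolding h_def by blast
  have inj: "inj_on h (P - {S})"
    by (rule inj_onI) (metis DiffD1 all_not_in_conv h_disj ne sub subset_iff)
  \<comment> \<open>Old vertices of \<open>B\<close> have a neighbour in \<open>A\<close> already;
    for a moved vertex \<open>f_dom\<close> gives one, because \<open>A\<close> dominates its target
    \<open>B\<close>.\<close>
  have dom: "set_dominates G (h A) (h B)"
    if A: "A \<in> P - {S}" and B: "B \<in> P - {S}" and "A \<noteq> B" and AB: "set_dominates G A B" for A B
  proof -
    have "has_nbr_in G x A" if "x \<in> h B" for x
      using that AB f_dom[of x A] A B \<open>A \<noteq> B\<close> by (auto simp: h_def set_dominates_iff)
    then show ?thesis using has_nbr_in_mono[OF _ sub] by (auto simp: set_dominates_iff)
  qed
  have sink: "set_dominates G (h A) {v}" if "A \<in> P - {S}" for A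
    using v_nbr[OF that] has_nbr_in_mono[OF _ sub] by (auto simp: set_dominates_iff)
  have un': "\<Union>Q = pverts G"
  proof
    have "h A \<subseteq> \<Union>P" if "A \<in> P" for A using that S by (auto simp: h_def)
    then show "\<Union>Q \<subseteq> pverts G" using v S un unfolding Q_def by blast
    have "x \<in> \<Union>Q" if x: "x \<in> A" "A \<in> P" for x A
    proof (cases "A = S")
      case True
      then show ?thesis using x f[of x] by (auto simp: Q_def h_def)
    next
      case False
      then show ?thesis using x sub[of A] by (auto simp: Q_def)
    qed
    then show "pverts G \<subseteq> \<Union>Q" using un by blast
  qed
  have "{} \<notin> Q"
    using ne sub by (force simp: Q_def)
  moreover have "disjoint Q"
  proof -
    have "h A \<inter> h B = {}" if "A \<in> P - {S}" "B \<in> P - {S}" "h A \<noteq> h B" for A B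
      using h_disj that by blast
    then show ?thesis
      using v_notin by (auto simp: disjoint_def Q_def)
  qed
  ultimately have "partition_on (pverts G) Q"
    using un' by (auto simp: partition_on_def)
  moreover have "set_dominates G X Y \<or> set_dominates G Y X" if "X \<in> Q" "Y \<in> Q" "X \<noteq> Y" for X Y
    using that sink dom semi unfolding Q_def by (auto; metis DiffI singletonD)
  ultimately have "upper_domatic_partition G Q"
    by (auto simp: upper_domatic_partition_def)
  moreover have "card Q = card P"
  proof -
    have "{v} \<notin> h ` (P - {S})" using v_notin by auto
    then have "card Q = Suc (card (P - {S}))"
      using finP inj by (simp add: Q_def card_image)
    also have "\<dots> = card P" using S finP by (simp add: card_Suc_Diff1 del: card_Diff_insert)
    finally show ?thesis .
  qed
  moreover have "sink_set G Q {v}"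
    using sink by (auto simp: sink_set_def Q_def)
  ultimately show ?thesis by blast
qed

text \<open>Domination in either direction yields an edge between \<open>S\<close> and
  \<open>A0\<close>; its end in \<open>S\<close> is the \<open>v\<close> to keep. The rest of
  \<open>S\<close> moves to \<open>A0\<close>, as each of its vertices has neighbours in all
  remaining parts.\<close>

lemma sink_partition_if_one_nondominator:
  assumes G: "pair_graph G" and P: "upper_domatic_partition G P" and finP: "finite P" and S: "S \<in> P"
    and A0: "A0 \<in> P - {S}" "\<And>A. A \<in> P - {S, A0} \<Longrightarrow> set_dominates G A S"
  shows "\<exists>Q v. upper_domatic_partition G Q \<and> card Q = card P \<and> sink_set G Q {v}"
proof -
  have ne: "S \<noteq> {}" "A0 \<noteq> {}"
    using P S A0 by (auto simp: upper_domatic_partition_def partition_on_def)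
  have "set_dominates G A0 S \<or> set_dominates G S A0"
    using P S A0 by (auto simp: upper_domatic_partition_def)
  then obtain v where v: "v \<in> S" "has_nbr_in G v A0"
    using set_dominates_obtain[OF G] ne by (metis ex_in_conv set_dominates_iff)
  have v_nbr: "has_nbr_in G v A" if "A \<in> P - {S}" for A
    using that v A0 by (cases "A = A0") (auto simp: set_dominates_iff)
  have "\<exists>A\<in>P - {S}. \<forall>B\<in>P - {S, A}. has_nbr_in G x B \<or> \<not> set_dominates G B A" if "x \<in> S" for x
    using that A0 by (intro bexI[of _ A0]) (auto simp: set_dominates_iff)
  from sink_partition_by_moving[OF P finP S v(1) v_nbr this] show ?thesis by blast
qed

text \<open>Assumption \<open>two\<close> says that every out-degree is at least two: varying
  \<open>z\<close> gives a second out-neighbour. Asymmetry then leaves no freedom on five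
  vertices.\<close>

lemma regular_tournament_5:
  fixes R :: "'b \<Rightarrow> 'b \<Rightarrow> bool"
  assumes card: "card P = 5"
    and asym: "\<And>x y. x \<in> P \<Longrightarrow> y \<in> P \<Longrightarrow> R x y \<Longrightarrow> \<not> R y x"
    and two: "\<And>x z. x \<in> P \<Longrightarrow> z \<in> P \<Longrightarrow> \<exists>y\<in>P - {x, z}. R x y"
  obtains a b c d e where "P = {a, b, c, d, e}" "distinct [a, b, c, d, e]"
    "R a b" "R a c" "R b c" "R b d" "R c d" "R c e" "R d e" "R d a" "R e a" "R e b"
proof -
  obtain a where a: "a \<in> P" using card by fastforce
  obtain b0 where b0: "b0 \<in> P - {a}" "R a b0" using two[OF a a] by auto
  obtain c0 where c0: "c0 \<in> P - {a, b0}" "R a c0" using two[OF a, of b0] b0 by auto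
  \<comment> \<open>By asymmetry two out-neighbours of \<open>a\<close> can be named so that no arc
    runs from \<open>c\<close> to \<open>b\<close>; \<open>d\<close> and \<open>e\<close> are named
    likewise below.\<close>
  obtain b c where bc: "b \<in> P - {a}" "c \<in> P - {a, b}" "R a b" "R a c" "\<not> R c b"
    using b0 c0 asym by (metis Diff_iff insert_iff)
  have "card (P - {a, b, c}) = 2" using a bc card by (subst card_Diff_subset) auto
  then obtain d0 e0 where de0: "P - {a, b, c} = {d0, e0}" "d0 \<noteq> e0" by (auto simp: card_2_iff)
  obtain d e where de: "P - {a, b, c} = {d, e}" "d \<noteq> e" "\<not> R e d"
    using de0 asym by (metis DiffD1 insertCI insert_commute)
  have Peq: "P = {a, b, c, d, e}" using de a bc by auto
  have irr: "\<not> R x x" if "x \<in> P" for x using asym that by blast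
  have dist: "distinct [a, b, c, d, e]" using bc de by auto
  \<comment> \<open>In the order \<open>c\<close>, \<open>e\<close>, \<open>b\<close>,
    \<open>d\<close>, each vertex has two of the others already excluded as out-neighbours, so both
    remaining ones are forced.\<close>
  have cd: "R c d" "R c e"
    using two[of c e] two[of c d] asym[of a c] irr[of c] bc Peq by auto
  then have ea: "R e a" "R e b"
    using two[of e a] two[of e b] asym[of c e] irr[of e] de Peq by auto
  then have b: "R b c" "R b d"
    using two[of b c] two[of b d] asym[of a b] asym[of e b] irr[of b] bc Peq by auto
  then have "R d e" "R d a"
    using two[of d e] two[of d a] asym[of b d] asym[of c d] irr[of d] cd Peq by auto
  then show ?thesis using that[OF Peq dist] bc cd ea b by blast
qed

theorem theorem5:
  fixes G :: "'a pair_pre_digraph"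
  assumes "pair_graph G"
    and "two_K2_free G"
    and "upper_domatic_number G = 5"
  shows "\<exists>P. D_partition G P \<and> (\<exists>S. sink_set G P S)"
proof -
  have "Max (card ` {P. upper_domatic_partition G P}) \<in> card ` {P. upper_domatic_partition G P}"
    using upper_domatic_sizes_finite[OF assms(1)] upper_domatic_sizes_nonempty by (rule Max_in)
  then obtain P where P: "upper_domatic_partition G P" and card: "card P = 5"
    using assms(3) by (auto simp: upper_domatic_number_def)
  have finP: "finite P" using card by (simp add: card_ge_0_finite)
  have "\<exists>Q v. upper_domatic_partition G Q \<and> card Q = card P \<and> sink_set G Q {v}"
  proof (cases "\<exists>S\<in>P. \<exists>A0\<in>P. \<forall>A\<in>P - {S, A0}. set_dominates G A S")
    case True
    then obtain S A0 where S: "S \<in> P" "A0 \<in> P" "\<forall>A\<in>P - {S, A0}. set_dominates G A S" by blast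
    have "P \<noteq> {S}" using card by auto
    \<comment> \<open>If \<open>A0 = S\<close>, all other parts dominate \<open>S\<close>, and any
      of them can serve as the exception.\<close>
    then obtain A1 where A1: "A1 \<in> P - {S}" "A0 = S \<or> A1 = A0"
      using S by blast
    have "set_dominates G A S" if "A \<in> P - {S, A1}" for A
      using that S(3) A1(2) by blast
    from sink_partition_if_one_nondominator[OF assms(1) P finP S(1) A1(1) this] show ?thesis .
  next
    case False
    \<comment> \<open>An arc is strict domination: \<open>B\<close> fails to dominate
      \<open>A\<close>, so \<open>A\<close> dominates \<open>B\<close>. Failure of the first case
      gives each part two out-neighbours.\<close>
    define R where "R A B \<longleftrightarrow> \<not> set_dominates G B A \<and> A \<noteq> B" for A B
    have R_dom: "set_dominates G A B" if "R A B" "A \<in> P" "B \<in> P" for A B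
      using that P by (auto simp: R_def upper_domatic_partition_def)
    obtain V0 V1 V2 V3 V4 where V: "P = {V0, V1, V2, V3, V4}" "distinct [V0, V1, V2, V3, V4]"
      "R V0 V1" "R V0 V2" "R V1 V2" "R V1 V3" "R V2 V3" "R V2 V4" "R V3 V4" "R V3 V0" "R V4 V0" "R V4 V1"
    proof (rule regular_tournament_5[OF card])
      show "\<not> R y x" if "x \<in> P" "y \<in> P" "R x y" for x y
        using that R_dom by (auto simp: R_def)
      show "\<exists>y\<in>P - {x, z}. R x y" if "x \<in> P" "z \<in> P" for x z
        using that False unfolding R_def by blast
    qed
    \<comment> \<open>All of \<open>A\<close> can move to \<open>B\<close>: \<open>C\<close> does
      not dominate \<open>B\<close>, while \<open>D\<close> and \<open>E\<close> dominate
      \<open>A\<close>. So one \<open>v\<close> with neighbours in all other parts suffices.\<close>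
    have main: ?thesis
      if PA: "P = {A, B, C, D, E}" "distinct [A, B, C, D, E]"
        and R: "R B C" "R D A" "R E A"
        and v: "v \<in> A" "has_nbr_in G v B" "has_nbr_in G v C" "has_nbr_in G v D" "has_nbr_in G v E"
      for v A B C D E
    proof -
      have v_nbr: "has_nbr_in G v X" if "X \<in> P - {A}" for X
        using that PA v by auto
      have AP: "A \<in> P" using PA by simp
      have "\<exists>X\<in>P - {A}. \<forall>Y\<in>P - {A, X}. has_nbr_in G x Y \<or> \<not> set_dominates G Y X" if x: "x \<in> A" for x
      proof (intro bexI[of _ B] ballI)
        fix Y assume "Y \<in> P - {A, B}"
        then consider "Y = C" | "Y = D" | "Y = E" using PA(1) by blast
        then show "has_nbr_in G x Y \<or> \<not> set_dominates G Y B"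
        proof cases
          case 1
          then show ?thesis using R(1) by (simp add: R_def)
        next
          case 2
          then show ?thesis using R_dom[OF R(2)] PA(1) x by (simp add: set_dominates_iff)
        next
          case 3
          then show ?thesis using R_dom[OF R(3)] PA(1) x by (simp add: set_dominates_iff)
        qed
      qed (use PA in auto)
      from sink_partition_by_moving[OF P finP AP v(1) v_nbr this] show ?thesis by blast
    qed
    show ?thesis
    proof (rule ccontr)
      assume neg: "\<not> ?thesis"
      have ne: "V4 \<noteq> {}" using P V(1) by (auto simp: upper_domatic_partition_def partition_on_def)
      have dom: "set_dominates G V0 V2" "set_dominates G V1 V3" "set_dominates G V2 V4" "set_dominates G V3 V4"
        "set_dominates G V3 V0" "set_dominates G V4 V0" "set_dominates G V4 V1" "set_dominates G V0 V1"
        "set_dominates G V1 V2" "set_dominates G V2 V3"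
        using V R_dom by auto
      \<comment> \<open>The vertices \<open>r\<close>, \<open>q\<close>, \<open>p\<close>,
        \<open>b\<close> are chosen so that each is known to have neighbours in all other parts but
        one.\<close>
      obtain r where r: "r \<in> V3" "has_nbr_in G r V4"
        using set_dominates_obtain[OF assms(1) dom(4) ne] .
      obtain q where q: "q \<in> V2" "has_nbr_in G q V4"
        using set_dominates_obtain[OF assms(1) dom(3) ne] .
      obtain p where p: "p \<in> V1" "(p, r) \<in> parcs G"
        using dom(2) r(1) by (auto simp: set_dominates_def)
      obtain b where b: "b \<in> V0" "(b, q) \<in> parcs G"
        using dom(1) q(1) by (auto simp: set_dominates_def)
      have pV3: "has_nbr_in G p V3" and bV2: "has_nbr_in G b V2"
        using p(2) b(2) q(1) r(1) has_nbr_in_arc(1)[OF assms(1)] by blast+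
      note nbr = dom[unfolded set_dominates_iff, THEN bspec]
      \<comment> \<open>The tournament is invariant under cyclic shifts, so \<open>main\<close>
        applies with any part in first place.\<close>
      have rot: "P = {V1, V2, V3, V4, V0}" "P = {V2, V3, V4, V0, V1}" "P = {V3, V4, V0, V1, V2}"
        using V(1) by blast+
      have dist: "distinct [V1, V2, V3, V4, V0]" "distinct [V2, V3, V4, V0, V1]"
        "distinct [V3, V4, V0, V1, V2]"
        using V(2) by auto
      \<comment> \<open>A neighbour in the one missing part would meet the conditions of
        \<open>main\<close>. The four exclusions make the edges \<open>p r\<close> and
        \<open>b q\<close> independent.\<close>
      have "\<not> has_nbr_in G r V0"
        using neg main[OF rot(3) dist(3) V(11) V(6) V(7) r(1) r(2) _ nbr(2)[OF r(1)] nbr(10)[OF r(1)]]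
        by blast
      moreover have "\<not> has_nbr_in G p V2"
        using neg main[OF rot(1) dist(1) V(7) V(12) V(3) p(1) _ pV3 nbr(7)[OF p(1)] nbr(8)[OF p(1)]]
        by blast
      moreover have "\<not> has_nbr_in G q V3"
        using neg main[OF rot(2) dist(2) V(9) V(4) V(5) q(1) _ q(2) nbr(1)[OF q(1)] nbr(9)[OF q(1)]]
        by blast
      moreover have "\<not> has_nbr_in G b V1"
        using neg main[OF V(1) V(2) V(5) V(10) V(11) b(1) _ bV2 nbr(5)[OF b(1)] nbr(6)[OF b(1)]]
        by blast
      ultimately have non: "(p, b) \<notin> parcs G" "(p, q) \<notin> parcs G" "(r, b) \<notin> parcs G" "(r, q) \<notin> parcs G"
        using p(1) q(1) r(1) b(1) has_nbr_in_arc[OF assms(1)] by blast+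
      have neq: "x \<noteq> y" if "x \<in> X" "y \<in> Y" "X \<in> P" "Y \<in> P" "X \<noteq> Y" for x y X Y
        using that P by (auto simp: upper_domatic_partition_def partition_on_def disjoint_def)
      have "distinct [p, r, b, q]"
        using neq[OF p(1) r(1)] neq[OF b(1) p(1)] neq[OF p(1) q(1)]
          neq[OF b(1) r(1)] neq[OF q(1) r(1)] neq[OF b(1) q(1)] V(1,2) by simp
      then show False
        using assms(2) p(2) b(2) non two_K2_free_iff[OF assms(1)] by blast
    qed
  qed
  then show ?thesis
    using card assms(3) by (auto simp: D_partition_def)
qed

end
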